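(* Let $n\ge 1$ and $0\le d\le n-1$ be integers. If $\pi$ is chosen uniformly at random from the set of permutations $\pi\in S_n$ with $\mathrm{Des}(\pi)=d$, then the expected value of $\pi(1)$ is $d+1$ and the expected value of $\pi(n)$ is $n-d$.
   Context: $S_n$ is the set of permutations of $\{1,\dots,n\}$. A descent of $\pi\in S_n$ is an index $i$ with $1\le i\le n-1$ and $\pi(i)>\pi(i+1)$; $\mathrm{Des}(\pi)$ is the number of descents of $\pi$. *)

theory Defs
  imports "HOL-Probability.Probability" "HOL-Combinatorics.Permutations"
begin

definition Des :: "nat \<Rightarrow> (nat \<Rightarrow> nat) \<Rightarrow> nat" where
  "Des n \<pi> = card {i. 1 \<le> i \<and> i \<le> n - 1 \<and> \<pi> i > \<pi> (i + 1)}"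

definition perms_des :: "nat \<Rightarrow> nat \<Rightarrow> (nat \<Rightarrow> nat) set" where
  "perms_des n d = {\<pi>. \<pi> permutes {1..n} \<and> Des n \<pi> = d}"

text \<open>
  The following two facts make \<open>pmf_of_set (perms_des n d)\<close> the uniform
  distribution; \<open>pmf_of_set\<close> is unspecified on empty or infinite sets.
\<close>

lemma finite_perms_des: "finite (perms_des n d)"
  by (rule finite_subset[OF _ finite_permutations[of "{1..n}"]]) (auto simp: perms_des_def)

lemma perms_des_nonempty:
  assumes "n \<ge> 1" "d \<le> n - 1"
  shows "perms_des n d \<noteq> {}"
proof -
  define \<pi> where "\<pi> = (\<lambda>i::nat. if 1 \<le> i \<and> i \<le> d + 1 then d + 2 - i else i)"
  have inv: "\<pi> (\<pi> i) = i" for i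
    by (auto simp: \<pi>_def)
  have "\<pi> permutes {1..n}"
    unfolding permutes_def
  proof (intro conjI allI impI)
    show "\<pi> i = i" if "i \<notin> {1..n}" for i
      using that assms by (auto simp: \<pi>_def)
    show "\<exists>!x. \<pi> x = y" for y
      using inv by metis
  qed
  moreover have "{i. 1 \<le> i \<and> i \<le> n - 1 \<and> \<pi> i > \<pi> (i + 1)} = {1..d}"
    using assms by (auto simp: \<pi>_def split: if_splits)
  hence "Des n \<pi> = d"
    by (simp add: Des_def)
  ultimately show ?thesis
    by (auto simp: perms_des_def)
qed

end

theory Submission
  imports Defs "HOL-Number_Theory.Cong"
begin

text \<open>
  Put a \<open>0\<close> in front of the word of \<open>\<pi>\<close>, so that \<open>\<pi>\<close> becomes a circular arrangement of the residues
  modulo \<open>n + 1\<close>. Rotating it to start at position \<open>p\<close> and subtracting the letter at \<open>p\<close> gives an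
  action of the cyclic group of order \<open>n + 1\<close>. The sum of the residues of \<open>\<pi> (i + 1) - \<pi> i\<close> around
  the circle is invariant under this action and equals \<open>n + 1\<close> times the number \<open>Des \<pi> + 1\<close> of
  circular descents, so the action preserves \<open>Des\<close>. The first letter of the \<open>p\<close>-th rotation is the
  residue of \<open>\<pi> (p + 1) - \<pi> p\<close>; hence the average of the first letter over each orbit is
  \<open>Des \<pi> + 1\<close>. Finally, the last letter of the rotation by one step is \<open>n + 1 - \<pi> 1\<close>.
\<close>

text \<open>The difference is taken in \<open>int\<close> because subtraction on \<open>nat\<close>
  truncates. Beyond \<open>n\<close> the map is the identity, as \<open>permutes\<close>
  demands.\<close>

definition rotate_perm :: "nat \<Rightarrow> nat \<Rightarrow> (nat \<Rightarrow> nat) \<Rightarrow> nat \<Rightarrow> nat" where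
  "rotate_perm n p \<pi> i =
     (if i \<le> n then nat ((int (\<pi> ((p + i) mod Suc n)) - int (\<pi> p)) mod int (Suc n)) else i)"

definition circular_rise :: "nat \<Rightarrow> (nat \<Rightarrow> nat) \<Rightarrow> int" where
  "circular_rise n \<pi> = (\<Sum>i\<le>n. (int (\<pi> (Suc i mod Suc n)) - int (\<pi> i)) mod int (Suc n))"

lemma int_rotate_perm:
  assumes "i \<le> n"
  shows "int (rotate_perm n p \<pi> i) = (int (\<pi> ((p + i) mod Suc n)) - int (\<pi> p)) mod int (Suc n)"
  using assms by (simp add: rotate_perm_def)

text \<open>This supplies the prepended 0: the circular word is just \<open>\<pi>\<close> restricted
  to \<open>{..n}\<close>.\<close>

lemma permutes_0: "\<pi> permutes {1..n} \<Longrightarrow> \<pi> 0 = (0::nat)"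
  by (simp add: permutes_not_in)

lemma permutes_le:
  assumes "\<pi> permutes {1..n}" "i \<le> n"
  shows "\<pi> i \<le> (n::nat)"
  using assms permutes_0[OF assms(1)] permutes_in_image[OF assms(1), of i]
  by (cases "i = 0") auto

lemma bij_betw_add_mod:
  fixes m p :: nat
  assumes "0 < m"
  shows "bij_betw (\<lambda>i. (p + i) mod m) {..<m} {..<m}"
proof -
  have "inj_on (\<lambda>i. (p + i) mod m) {..<m}"
  proof (rule inj_onI)
    fix i j assume "i \<in> {..<m}" "j \<in> {..<m}" "(p + i) mod m = (p + j) mod m"
    then show "i = j"
      using cong_add_lcancel_nat[of p i j m] by (simp add: cong_def)
  qed
  moreover have "(\<lambda>i. (p + i) mod m) ` {..<m} \<subseteq> {..<m}"
    using assms by auto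
  ultimately show ?thesis
    by (simp add: bij_betw_def endo_inj_surj)
qed

lemma bij_betw_Suc_add_mod: "bij_betw (\<lambda>i. (p + i) mod Suc n) {..n} {..n}"
  using bij_betw_add_mod[of "Suc n" p] by (simp add: lessThan_Suc_atMost)

text \<open>Shifting positions and subtracting a constant letter are both injective modulo
  \<open>n + 1\<close>, and the letters at positions 0 to \<open>n\<close> are pairwise distinct
  residues.\<close>

lemma rotate_perm_permutes:
  assumes \<pi>: "\<pi> permutes {1..n}" and p: "p \<le> n"
  shows "rotate_perm n p \<pi> permutes {1..n}"
proof -
  let ?r = "rotate_perm n p \<pi>"
  have inj: "inj_on ?r {..n}"
  proof (rule inj_onI)
    fix i j assume ij: "i \<in> {..n}" "j \<in> {..n}" "?r i = ?r j"
    let ?i = "(p + i) mod Suc n" and ?j = "(p + j) mod Suc n"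
    have "[int (\<pi> ?i) - int (\<pi> p) = int (\<pi> ?j) - int (\<pi> p)] (mod int (Suc n))"
      using ij int_rotate_perm[of i n p \<pi>] int_rotate_perm[of j n p \<pi>] by (simp add: cong_def)
    then have "[int (\<pi> ?i) = int (\<pi> ?j)] (mod int (Suc n))"
      using cong_add_rcancel[of "int (\<pi> ?i)" "- int (\<pi> p)" "int (\<pi> ?j)" "int (Suc n)"] by simp
    then have "[\<pi> ?i = \<pi> ?j] (mod Suc n)"
      by (simp only: cong_int_iff)
    moreover have "\<pi> ?i < Suc n" "\<pi> ?j < Suc n"
      using permutes_le[OF \<pi>] by (simp_all add: less_Suc_eq_le)
    ultimately have "\<pi> ?i = \<pi> ?j"
      by (simp add: cong_def)
    then have "?i = ?j"
      using permutes_inj[OF \<pi>] by (simp add: inj_eq)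
    then show "i = j"
      using ij bij_betw_imp_inj_on[OF bij_betw_Suc_add_mod[of p n]] by (auto dest: inj_onD)
  qed
  have zero: "?r 0 = 0"
    using p by (simp add: rotate_perm_def)
  have le: "?r i \<le> n" if "i \<le> n" for i
  proof -
    have "int (?r i) < int (Suc n)"
      using that by (simp only: int_rotate_perm) simp
    then show ?thesis by simp
  qed
  \<comment> \<open>The letter 0 is already taken by position 0.\<close>
  have pos: "?r i \<noteq> 0" if "i \<in> {1..n}" for i
    using inj_onD[OF inj, of i 0] zero that by auto
  have "?r ` {1..n} \<subseteq> {1..n}"
    using le pos by (force simp: Suc_le_eq)
  moreover have "inj_on ?r {1..n}"
    using inj by (rule inj_on_subset) auto
  ultimately have "bij_betw ?r {1..n} {1..n}"
    by (simp add: bij_betw_def endo_inj_surj)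
  moreover have "?r i = i" if "i \<notin> {1..n}" for i
    using that zero by (cases "i = 0") (auto simp: rotate_perm_def)
  ultimately show ?thesis
    by (rule bij_imp_permutes)
qed

text \<open>The letter \<open>\<pi> p\<close> subtracted by the inner rotation cancels when the
  outer one takes a difference; only the letter at position \<open>p + q\<close> remains
  subtracted.\<close>

lemma rotate_perm_rotate_perm:
  assumes "p \<le> n" "q \<le> n"
  shows "rotate_perm n q (rotate_perm n p \<pi>) = rotate_perm n ((p + q) mod Suc n) \<pi>"
proof
  fix i
  show "rotate_perm n q (rotate_perm n p \<pi>) i = rotate_perm n ((p + q) mod Suc n) \<pi> i"
  proof (cases "i \<le> n")
    case True
    have "(q + i) mod Suc n \<le> n" by (simp add: less_Suc_eq_le[symmetric])
    moreover have "(p + (q + i) mod Suc n) mod Suc n = ((p + q) mod Suc n + i) mod Suc n"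
      by (simp add: mod_simps add.assoc)
    ultimately have "int (rotate_perm n q (rotate_perm n p \<pi>) i)
        = int (rotate_perm n ((p + q) mod Suc n) \<pi> i)"
      using True assms by (simp only: int_rotate_perm mod_diff_eq) simp
    then show ?thesis by simp
  qed (simp add: rotate_perm_def)
qed

lemma rotate_perm_0:
  assumes "\<pi> permutes {1..n}"
  shows "rotate_perm n 0 \<pi> = \<pi>"
proof
  fix i
  show "rotate_perm n 0 \<pi> i = \<pi> i"
    using permutes_le[OF assms, of i] permutes_0[OF assms] permutes_not_in[OF assms, of i]
    by (cases "i \<le> n") (auto simp: rotate_perm_def)
qed

text \<open>The subtracted letter cancels in differences of neighbours, so rotation only permutes
  the summands cyclically.\<close>

lemma circular_rise_rotate_perm:
  assumes "p \<le> n"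
  shows "circular_rise n (rotate_perm n p \<pi>) = circular_rise n \<pi>"
proof -
  let ?f = "\<lambda>i. (int (\<pi> (Suc i mod Suc n)) - int (\<pi> i)) mod int (Suc n)"
  have "circular_rise n (rotate_perm n p \<pi>) = (\<Sum>i\<le>n. ?f ((p + i) mod Suc n))"
    unfolding circular_rise_def
  proof (rule sum.cong[OF refl])
    fix i assume "i \<in> {..n}"
    then have i: "i \<le> n" by simp
    have Si: "Suc i mod Suc n \<le> n" by (simp add: less_Suc_eq_le[symmetric])
    have "(p + Suc i mod Suc n) mod Suc n = Suc ((p + i) mod Suc n) mod Suc n"
      by (simp add: mod_simps)
    then show "(int (rotate_perm n p \<pi> (Suc i mod Suc n)) - int (rotate_perm n p \<pi> i)) mod int (Suc n)
        = ?f ((p + i) mod Suc n)"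
      by (simp only: int_rotate_perm[OF i] int_rotate_perm[OF Si] mod_diff_eq) simp
  qed
  also have "\<dots> = circular_rise n \<pi>"
    unfolding circular_rise_def by (rule sum.reindex_bij_betw[OF bij_betw_Suc_add_mod])
  finally show ?thesis .
qed

lemma diff_mod_eq_if:
  fixes a b m :: int
  assumes "0 \<le> a" "a < m" "0 \<le> b" "b < m"
  shows "(a - b) mod m = a - b + (if a < b then m else 0)"
proof (cases "a < b")
  case True
  then have "(a - b + m) mod m = a - b + m"
    using assms by (intro mod_pos_pos_trivial) auto
  then show ?thesis using True by simp
qed (use assms in simp)

text \<open>Without the reduction modulo \<open>n + 1\<close> the differences would cancel around
  the circle; the reduction adds \<open>n + 1\<close> at each circular descent.\<close>

lemma circular_rise_eq_Des:
  assumes \<pi>: "\<pi> permutes {1..n}" and n: "n \<ge> 1"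
  shows "circular_rise n \<pi> = int (Suc n) * (int (Des n \<pi>) + 1)"
proof -
  let ?s = "\<lambda>i. Suc i mod Suc n"
  let ?D = "{i. 1 \<le> i \<and> i \<le> n - 1 \<and> \<pi> i > \<pi> (i + 1)}"
  have s: "?s i \<le> n" for i by (simp add: less_Suc_eq_le[symmetric])
  have "circular_rise n \<pi>
      = (\<Sum>i\<le>n. int (\<pi> (?s i)) - int (\<pi> i) + (if \<pi> (?s i) < \<pi> i then int (Suc n) else 0))"
    unfolding circular_rise_def
  proof (rule sum.cong[OF refl])
    fix i assume "i \<in> {..n}"
    then have "\<pi> i \<le> n" "\<pi> (?s i) \<le> n"
      using permutes_le[OF \<pi>] s by auto
    then show "(int (\<pi> (?s i)) - int (\<pi> i)) mod int (Suc n)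
        = int (\<pi> (?s i)) - int (\<pi> i) + (if \<pi> (?s i) < \<pi> i then int (Suc n) else 0)"
      using diff_mod_eq_if[of "int (\<pi> (?s i))" "int (Suc n)" "int (\<pi> i)"] by simp
  qed
  also have "\<dots> = (\<Sum>i\<le>n. int (\<pi> (?s i))) - (\<Sum>i\<le>n. int (\<pi> i))
      + (\<Sum>i\<le>n. if \<pi> (?s i) < \<pi> i then int (Suc n) else 0)"
    by (simp only: sum.distrib sum_subtractf)
  also have "(\<Sum>i\<le>n. int (\<pi> (?s i))) = (\<Sum>i\<le>n. int (\<pi> i))"
    using sum.reindex_bij_betw[OF bij_betw_Suc_add_mod[of 1 n], of "\<lambda>i. int (\<pi> i)"] by simp
  also have "(\<Sum>i\<le>n. if \<pi> (?s i) < \<pi> i then int (Suc n) else 0)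
      = int (Suc n) * int (card {i \<in> {..n}. \<pi> (?s i) < \<pi> i})"
    by (subst sum.inter_filter[symmetric]) auto
  \<comment> \<open>Position 0 is never a circular descent because its letter is 0. Position
    \<open>n\<close> always is one, because it is followed by that 0; this accounts for the extra
    1.\<close>
  also have "{i \<in> {..n}. \<pi> (?s i) < \<pi> i} = insert n ?D"
  proof (intro set_eqI iffI)
    fix i assume i: "i \<in> {i \<in> {..n}. \<pi> (?s i) < \<pi> i}"
    then have "i \<noteq> 0" using permutes_0[OF \<pi>] by (intro notI) simp
    then show "i \<in> insert n ?D" using i by (cases "i = n") auto
  next
    fix i assume i: "i \<in> insert n ?D"
    have "\<pi> n \<noteq> 0"
      using permutes_in_image[OF \<pi>, of n] n by auto
    then show "i \<in> {i \<in> {..n}. \<pi> (?s i) < \<pi> i}"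
      using i n permutes_0[OF \<pi>] by (cases "i = n") auto
  qed
  also have "card (insert n ?D) = Suc (Des n \<pi>)"
  proof -
    have "finite ?D" by (rule finite_subset[of _ "{..n}"]) auto
    moreover have "n \<notin> ?D" using n by auto
    ultimately show ?thesis by (simp add: Des_def)
  qed
  finally show ?thesis by simp
qed

lemma rotate_perm_in_perms_des:
  assumes \<pi>: "\<pi> \<in> perms_des n d" and n: "n \<ge> 1" and p: "p \<le> n"
  shows "rotate_perm n p \<pi> \<in> perms_des n d"
proof -
  have perm: "\<pi> permutes {1..n}" and d: "Des n \<pi> = d"
    using \<pi> by (auto simp: perms_des_def)
  note perm' = rotate_perm_permutes[OF perm p]
  have "int (Suc n) * (int (Des n (rotate_perm n p \<pi>)) + 1) = int (Suc n) * (int (Des n \<pi>) + 1)"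
    using circular_rise_rotate_perm[OF p, of \<pi>]
    by (simp only: circular_rise_eq_Des[OF perm' n] circular_rise_eq_Des[OF perm n])
  then have "Des n (rotate_perm n p \<pi>) = Des n \<pi>"
    by (simp only: mult_cancel_left) simp
  then show ?thesis
    using perm' d by (simp add: perms_des_def)
qed

lemma bij_betw_rotate_perm:
  assumes n: "n \<ge> 1" and p: "p \<le> n"
  shows "bij_betw (rotate_perm n p) (perms_des n d) (perms_des n d)"
proof -
  \<comment> \<open>Rotation by \<open>-p\<close> is the inverse. The outer \<open>mod\<close>
    matters for \<open>p = 0\<close>, where \<open>Suc n - p\<close> exceeds
    \<open>n\<close>.\<close>
  define q where "q = (Suc n - p) mod Suc n"
  have q: "q \<le> n" by (simp add: q_def less_Suc_eq_le[symmetric])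
  have pq: "(p + q) mod Suc n = 0" "(q + p) mod Suc n = 0"
    using p by (simp_all add: q_def mod_simps)
  show ?thesis
  proof (rule bij_betw_byWitness[where f' = "rotate_perm n q"])
    show "\<forall>\<pi>\<in>perms_des n d. rotate_perm n q (rotate_perm n p \<pi>) = \<pi>"
      using rotate_perm_rotate_perm[OF p q] rotate_perm_0 pq by (auto simp: perms_des_def)
    show "\<forall>\<pi>\<in>perms_des n d. rotate_perm n p (rotate_perm n q \<pi>) = \<pi>"
      using rotate_perm_rotate_perm[OF q p] rotate_perm_0 pq by (auto simp: perms_des_def)
  qed (use rotate_perm_in_perms_des n p q in auto)
qed

lemma sum_first_rotate_perm:
  assumes "\<pi> \<in> perms_des n d" "n \<ge> 1"
  shows "(\<Sum>p\<le>n. real (rotate_perm n p \<pi> 1)) = real (Suc n) * (real d + 1)"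
proof -
  have "(\<Sum>p\<le>n. int (rotate_perm n p \<pi> 1)) = circular_rise n \<pi>"
    using assms(2) by (simp add: int_rotate_perm circular_rise_def)
  also have "\<dots> = int (Suc n) * (int d + 1)"
    using assms circular_rise_eq_Des by (simp add: perms_des_def)
  finally have "real_of_int (\<Sum>p\<le>n. int (rotate_perm n p \<pi> 1)) = real_of_int (int (Suc n) * (int d + 1))"
    by (simp only:)
  then show ?thesis by simp
qed

text \<open>Orbits need not be separated: every rotation permutes \<open>perms_des n d\<close>, so
  the sum may be replaced by its average over all \<open>n + 1\<close> rotations. After exchanging
  the sums, each \<open>\<pi>\<close> contributes the same amount.\<close>

lemma sum_first_perms_des:
  assumes "n \<ge> 1"
  shows "(\<Sum>\<pi>\<in>perms_des n d. real (\<pi> 1)) = real (card (perms_des n d)) * (real d + 1)"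
proof -
  let ?S = "perms_des n d"
  have "real (Suc n) * (\<Sum>\<pi>\<in>?S. real (\<pi> 1)) = (\<Sum>p\<le>n. \<Sum>\<pi>\<in>?S. real (\<pi> 1))"
    by simp
  also have "\<dots> = (\<Sum>p\<le>n. \<Sum>\<pi>\<in>?S. real (rotate_perm n p \<pi> 1))"
  proof (rule sum.cong[OF refl])
    fix p assume "p \<in> {..n}"
    then have "bij_betw (rotate_perm n p) ?S ?S"
      using assms by (simp add: bij_betw_rotate_perm)
    then show "(\<Sum>\<pi>\<in>?S. real (\<pi> 1)) = (\<Sum>\<pi>\<in>?S. real (rotate_perm n p \<pi> 1))"
      by (rule sum.reindex_bij_betw[symmetric])
  qed
  also have "\<dots> = (\<Sum>\<pi>\<in>?S. \<Sum>p\<le>n. real (rotate_perm n p \<pi> 1))"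
    by (rule sum.swap)
  also have "\<dots> = (\<Sum>\<pi>\<in>?S. real (Suc n) * (real d + 1))"
    using assms by (intro sum.cong refl sum_first_rotate_perm)
  also have "\<dots> = real (Suc n) * (real (card ?S) * (real d + 1))"
    by (simp add: mult_ac)
  finally show ?thesis
    by (simp only: mult_cancel_left) simp
qed

text \<open>Position \<open>1 + n\<close> wraps around to the prepended 0, so the last letter is the
  residue of \<open>- \<pi> 1\<close>, where \<open>\<pi> 1\<close> lies between 1 and
  \<open>n\<close>.\<close>

lemma rotate_perm_1_last:
  assumes \<pi>: "\<pi> permutes {1..n}" and n: "n \<ge> 1"
  shows "real (rotate_perm n 1 \<pi> n) = real (Suc n) - real (\<pi> 1)"
proof -
  have "\<pi> 1 \<noteq> 0" "\<pi> 1 \<le> n"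
    using permutes_in_image[OF \<pi>, of 1] n by auto
  then have "int (rotate_perm n 1 \<pi> n) = int (Suc n) - int (\<pi> 1)"
    using diff_mod_eq_if[of 0 "int (Suc n)" "int (\<pi> 1)"] permutes_0[OF \<pi>]
    by (simp add: int_rotate_perm)
  then show ?thesis by linarith
qed

lemma sum_last_perms_des:
  assumes "n \<ge> 1"
  shows "(\<Sum>\<pi>\<in>perms_des n d. real (\<pi> n)) = real (card (perms_des n d)) * (real n - real d)"
proof -
  let ?S = "perms_des n d"
  have "(\<Sum>\<pi>\<in>?S. real (\<pi> n)) = (\<Sum>\<pi>\<in>?S. real (rotate_perm n 1 \<pi> n))"
    using assms by (intro sum.reindex_bij_betw[symmetric] bij_betw_rotate_perm)
  also have "\<dots> = (\<Sum>\<pi>\<in>?S. real (Suc n) - real (\<pi> 1))"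
    using assms by (intro sum.cong refl rotate_perm_1_last) (auto simp: perms_des_def)
  also have "\<dots> = real (card ?S) * (real n - real d)"
    using sum_first_perms_des[OF assms, of d] by (simp add: sum_subtractf algebra_simps)
  finally show ?thesis .
qed

theorem theorem3:
  fixes n d :: nat
  assumes "n \<ge> 1" and "d \<le> n - 1"
  shows "measure_pmf.expectation (pmf_of_set (perms_des n d)) (\<lambda>\<pi>. real (\<pi> 1)) = real d + 1
       \<and> measure_pmf.expectation (pmf_of_set (perms_des n d)) (\<lambda>\<pi>. real (\<pi> n)) = real n - real d"
proof -
  have ne: "perms_des n d \<noteq> {}"
    using assms by (rule perms_des_nonempty)
  \<comment> \<open>The expectation is the sum divided by this cardinality, which must be
    cancelled.\<close>
  then have "card (perms_des n d) \<noteq> 0"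
    by (simp add: finite_perms_des)
  then show ?thesis
    using sum_first_perms_des[OF assms(1), of d] sum_last_perms_des[OF assms(1), of d]
    by (simp add: integral_pmf_of_set[OF ne finite_perms_des])
qed

end
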